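(* Let $\omega=(\cos\theta,\sin\theta)$ with $0<\theta<\frac{\pi}{4}$, and assume that $\alpha=\tan\theta$ is irrational. For $r>0$ set $\epsilon=2r\sqrt{1+\alpha^2}$ and $$A(\alpha,r)=1-\frac{d_{N(\alpha,r)}}{\epsilon},\qquad B(\alpha,r)=1-\frac{d_{N(\alpha,r)-1}-k(\alpha,r)\,d_{N(\alpha,r)}}{\epsilon},\qquad Q(\alpha,r)=\epsilon\, q_{N(\alpha,r)},$$ with $q_n$, $d_n$, $N(\alpha,r)$, $k(\alpha,r)$ defined in the context. Then, in the limit $r\to0^+$, the transfer map $T_r$ (defined in the context) is explicit in terms of $A,B,Q,N$ up to $O(r^2)$: $$T_r(h',\omega)=\mathbf{T}_{A(\alpha,r),B(\alpha,r),Q(\alpha,r),N(\alpha,r)}(h')+(O(r^2),0)\qquad\text{for each }h'\in\,]-1,1[.$$ Here, for each $(A,B,Q,N)\in K:=\,]0,1[^3\times\mathbf{Z}/2\mathbf{Z}$, with the notation $Q'=\frac{1-Q(1-B)}{1-A}$: $$\mathbf{T}_{A,B,Q,N}(h')=\left(Q,\;h'-2(-1)^N(1-A)\right)\quad\text{if }(-1)^Nh'\in\,]1-2A,1],$$ $$\mathbf{T}_{A,B,Q,N}(h')=\left(Q',\;h'+2(-1)^N(1-B)\right)\quad\text{if }(-1)^Nh'\in[-1,-1+2B[,$$ $$\mathbf{T}_{A,B,Q,N}(h')=\left(Q'+Q,\;h'+2(-1)^N(A-B)\right)\quad\text{if }(-1)^Nh'\in[-1+2B,1-2A].$$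
   Context: **The billiard table.** For $0<r<\frac12$, let $Z_r=\{x\in\mathbf{R}^2 : \mathrm{dist}(x,\mathbf{Z}^2)>r\}$, the plane minus the closed disks (obstacles) of radius $r$ centered at the points of $\mathbf{Z}^2$. For $x\in\partial Z_r$, $n_x$ is the unit normal at $x$ pointing into $Z_r$. Let $\Gamma_r^+=\{(x,\omega)\in\partial Z_r\times\mathbf{S}^1 : \omega\cdot n_x>0\}$, and $\Gamma_r^+/\mathbf{Z}^2$ its quotient by translations of $x$ by $\mathbf{Z}^2$. **Impact parameter and exit time.** For $(x,\omega)\in\Gamma_r^+$, $h_r(x,\omega)=\sin(\omega,n_x)$ is the sine of the oriented angle from $\omega$ to $n_x$, and $\tau_r(x,\omega)=\inf\{t>0 : x+t\omega\in\partial Z_r\}$. **Transfer map.** The map $\Gamma_r^+/\mathbf{Z}^2\ni(x,\omega)\mapsto(h_r(x,\omega),\omega)\in\,]-1,1[\times\mathbf{S}^1$ is a bijection; let $Y_r$ be its inverse. Given $(h',\omega)$, let $(x,\omega)=Y_r(h',\omega)$, let $x^+=x+\tau_r(x,\omega)\omega$ be the next collision point, and let $\omega^+=\omega-2(\omega\cdot n_{x^+})n_{x^+}$ be the velocity after specular reflection. The transfer map is $$T_r(h',\omega)=\big(r\,\tau_r(x,\omega),\;h_r(x^+,\omega^+)\big).$$ **Continued fraction data.** For irrational $\alpha\in\,]0,1[$, write $\alpha=[0;a_1,a_2,\ldots]=\cfrac{1}{a_1+\cfrac{1}{a_2+\cdots}}$ with positive integers $a_n$. Define, for $n\ge1$,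 $p_{n+1}=a_np_n+p_{n-1}$ with $p_0=1$, $p_1=0$, and $q_{n+1}=a_nq_n+q_{n-1}$ with $q_0=0$, $q_1=1$. For $n\ge0$ let $d_n=(-1)^{n-1}(q_n\alpha-p_n)$. With $[\cdot]$ the integer part, $$N(\alpha,r)=\inf\{n\ge0 : d_n\le 2r\sqrt{1+\alpha^2}\},\qquad k(\alpha,r)=-\left[\frac{2r\sqrt{1+\alpha^2}-d_{N(\alpha,r)-1}}{d_{N(\alpha,r)}}\right].$$ In $\mathbf{T}_{A,B,Q,N}$ only the class of $N$ modulo $2$ matters.
   Formalization: The first component of T_r is taken as 2rτ_r instead of rτ_r (with rτ_r it equals half the stated value up to O(r²), so the formula fails), and the equation is asserted only where T_r is defined, i.e. where the next collision is not tangential. *)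

theory Defs
  imports "HOL-Analysis.Analysis" "HOL-Library.Landau_Symbols"
begin

section \<open>The billiard table\<close>

text \<open>The plane is identified with the complex numbers, so that a direction
  \<open>(cos \<theta>, sin \<theta>)\<close> is \<open>cis \<theta>\<close>, and \<open>\<bullet>\<close> is the Euclidean inner product.\<close>

definition lattice :: "complex set" where
  "lattice = {Complex (of_int m) (of_int n) | m n. True}"

definition billiard_table :: "real \<Rightarrow> complex set" where
  "billiard_table r = {x. infdist x lattice > r}"

text \<open>For \<open>0 < r < 1/2\<close> the obstacles are disjoint disks, so a boundary point lies on exactly
  one circle; the inward normal of the table is the outward radial direction of that disk.\<close>

definition obstacle_centre :: "real \<Rightarrow> complex \<Rightarrow> complex" where
  "obstacle_centre r x = (THE c. c \<in> lattice \<and> dist x c = r)"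

definition unit_normal :: "real \<Rightarrow> complex \<Rightarrow> complex" where
  "unit_normal r x = (x - obstacle_centre r x) /\<^sub>R r"

definition Gamma_plus :: "real \<Rightarrow> (complex \<times> complex) set" where
  "Gamma_plus r = {(x, \<omega>). x \<in> frontier (billiard_table r) \<and> \<omega> \<in> sphere 0 1
                             \<and> \<omega> \<bullet> unit_normal r x > 0}"

definition lattice_equiv :: "real \<Rightarrow> ((complex \<times> complex) \<times> (complex \<times> complex)) set" where
  "lattice_equiv r = {((x, \<omega>), (y, v)). (x, \<omega>) \<in> Gamma_plus r \<and> (y, v) \<in> Gamma_plus r
                                         \<and> y - x \<in> lattice \<and> v = \<omega>}"

definition Gamma_plus_mod :: "real \<Rightarrow> (complex \<times> complex) set set" where
  "Gamma_plus_mod r = Gamma_plus r // lattice_equiv r"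


section \<open>The transfer map\<close>

text \<open>The oriented angle from \<open>\<omega>\<close> to \<open>n\<close> is the argument of \<open>n / \<omega>\<close>.\<close>

definition impact :: "real \<Rightarrow> complex \<times> complex \<Rightarrow> real" where
  "impact r = (\<lambda>(x, \<omega>). sin (Arg (unit_normal r x / \<omega>)))"

text \<open>The infimum is taken in the reals, hence carries no information if the ray never
  meets an obstacle; this does not happen for directions of irrational slope.\<close>

definition exit_time :: "real \<Rightarrow> complex \<times> complex \<Rightarrow> real" where
  "exit_time r = (\<lambda>(x, \<omega>). Inf {t. t > 0 \<and> x + t *\<^sub>R \<omega> \<in> frontier (billiard_table r)})"

text \<open>\<open>impact\<close> and \<open>exit_time\<close> are invariant under translation by the lattice, so the map
  \<open>(x, \<omega>) \<mapsto> (h\<^sub>r(x, \<omega>), \<omega>)\<close> is constant on each class, and below any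
  representative of a class may be used.\<close>

definition impact_class :: "real \<Rightarrow> (complex \<times> complex) set \<Rightarrow> real \<times> complex" where
  "impact_class r c = the_elem ((\<lambda>(x, \<omega>). (impact r (x, \<omega>), \<omega>)) ` c)"

definition Y :: "real \<Rightarrow> real \<times> complex \<Rightarrow> (complex \<times> complex) set" where
  "Y r = inv_into (Gamma_plus_mod r) (impact_class r)"

definition Y_rep :: "real \<Rightarrow> real \<times> complex \<Rightarrow> complex \<times> complex" where
  "Y_rep r z = (SOME p. p \<in> Y r z)"

definition next_collision :: "real \<Rightarrow> complex \<times> complex \<Rightarrow> complex \<times> complex" where
  "next_collision r = (\<lambda>(x, \<omega>).
     let y = x + exit_time r (x, \<omega>) *\<^sub>R \<omega>; n = unit_normal r y
     in (y, \<omega> - (2 * (\<omega> \<bullet> n)) *\<^sub>R n))"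

text \<open>The free path is scaled by the diameter \<open>2 r\<close> of the obstacles. This is the
  normalization for which \<open>Q = \<epsilon> q\<^sub>N\<close> with \<open>\<epsilon> = 2 r \<surd>(1 + \<alpha>\<^sup>2)\<close>: a flight between the
  obstacles at \<open>0\<close> and \<open>(q, p)\<close> with \<open>p \<approx> q \<alpha>\<close> has length close to \<open>q \<surd>(1 + \<alpha>\<^sup>2)\<close>.
  Scaling by \<open>r\<close>, as is sometimes written, gives half of that value.\<close>

definition transfer :: "real \<Rightarrow> real \<times> complex \<Rightarrow> real \<times> real" where
  "transfer r z = (2 * r * exit_time r (Y_rep r z), impact r (next_collision r (Y_rep r z)))"

text \<open>The impact parameter \<open>h\<^sub>r\<close> lives on \<open>Gamma_plus r\<close>, so the transfer map is defined where
  the reflected state belongs to that set, that is, where the next collision is not grazing.\<close>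

definition transfer_dom :: "real \<Rightarrow> (real \<times> complex) set" where
  "transfer_dom r = {z \<in> {-1<..<1} \<times> sphere 0 1. next_collision r (Y_rep r z) \<in> Gamma_plus r}"


section \<open>Continued fractions\<close>

text \<open>\<open>cf_rem \<alpha> n = [0; a\<^sub>n\<^sub>+\<^sub>1, a\<^sub>n\<^sub>+\<^sub>2, \<dots>]\<close>; the index of \<open>cf_digit\<close> starts at 1.\<close>

fun cf_rem :: "real \<Rightarrow> nat \<Rightarrow> real" where
  "cf_rem \<alpha> 0 = \<alpha>"
| "cf_rem \<alpha> (Suc n) = frac (1 / cf_rem \<alpha> n)"

definition cf_digit :: "real \<Rightarrow> nat \<Rightarrow> int" where
  "cf_digit \<alpha> n = \<lfloor>1 / cf_rem \<alpha> (n - 1)\<rfloor>"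

text \<open>Iterating the last clause gives \<open>\<alpha> = 1 / (a\<^sub>1 + 1 / (a\<^sub>2 + \<dots>))\<close>.\<close>

lemma cf_expansion:
  assumes "\<alpha> \<notin> \<rat>" "0 < \<alpha>" "\<alpha> < 1"
  shows "cf_rem \<alpha> n \<notin> \<rat>" "0 < cf_rem \<alpha> n" "cf_rem \<alpha> n < 1"
    and "0 < cf_digit \<alpha> (Suc n)"
    and "cf_rem \<alpha> n = 1 / (of_int (cf_digit \<alpha> (Suc n)) + cf_rem \<alpha> (Suc n))"
proof -
  have *: "cf_rem \<alpha> n \<notin> \<rat> \<and> 0 < cf_rem \<alpha> n \<and> cf_rem \<alpha> n < 1" for n
  proof (induction n)
    case 0
    then show ?case using assms by simp
  next
    case (Suc n)
    have inv: "1 / cf_rem \<alpha> n \<notin> \<rat>"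
    proof
      assume "1 / cf_rem \<alpha> n \<in> \<rat>"
      then have "inverse (1 / cf_rem \<alpha> n) \<in> \<rat>" by (rule Rats_inverse)
      with Suc show False by (simp add: inverse_eq_divide)
    qed
    have "frac (1 / cf_rem \<alpha> n) \<notin> \<rat>"
    proof
      assume "frac (1 / cf_rem \<alpha> n) \<in> \<rat>"
      then have "frac (1 / cf_rem \<alpha> n) + of_int \<lfloor>1 / cf_rem \<alpha> n\<rfloor> \<in> \<rat>" by (intro Rats_add) auto
      with inv show False by (simp add: frac_def)
    qed
    then show ?case
      by (metis Rats_0 cf_rem.simps(2) frac_ge_0 frac_lt_1 order_le_less)
  qed
  show "cf_rem \<alpha> n \<notin> \<rat>" "0 < cf_rem \<alpha> n" "cf_rem \<alpha> n < 1" using * by auto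
  then show "0 < cf_digit \<alpha> (Suc n)" by (simp add: cf_digit_def)
  show "cf_rem \<alpha> n = 1 / (of_int (cf_digit \<alpha> (Suc n)) + cf_rem \<alpha> (Suc n))"
    by (simp add: cf_digit_def frac_def)
qed

fun cf_p :: "real \<Rightarrow> nat \<Rightarrow> int" where
  "cf_p \<alpha> 0 = 1"
| "cf_p \<alpha> (Suc 0) = 0"
| "cf_p \<alpha> (Suc (Suc n)) = cf_digit \<alpha> (Suc n) * cf_p \<alpha> (Suc n) + cf_p \<alpha> n"

fun cf_q :: "real \<Rightarrow> nat \<Rightarrow> int" where
  "cf_q \<alpha> 0 = 0"
| "cf_q \<alpha> (Suc 0) = 1"
| "cf_q \<alpha> (Suc (Suc n)) = cf_digit \<alpha> (Suc n) * cf_q \<alpha> (Suc n) + cf_q \<alpha> n"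

text \<open>The exponent \<open>n + 1\<close> replaces \<open>n - 1\<close>, which would be truncated at \<open>n = 0\<close>.\<close>

definition cf_d :: "real \<Rightarrow> nat \<Rightarrow> real" where
  "cf_d \<alpha> n = (-1) ^ (n + 1) * (of_int (cf_q \<alpha> n) * \<alpha> - of_int (cf_p \<alpha> n))"

definition eps :: "real \<Rightarrow> real \<Rightarrow> real" where
  "eps \<alpha> r = 2 * r * sqrt (1 + \<alpha>\<^sup>2)"

definition N_index :: "real \<Rightarrow> real \<Rightarrow> nat" where
  "N_index \<alpha> r = Inf {n. cf_d \<alpha> n \<le> eps \<alpha> r}"

text \<open>As \<open>d\<^sub>0 = 1\<close>, the index \<open>N_index \<alpha> r\<close> is positive once \<open>eps \<alpha> r < 1\<close>; the truncated
  subtraction \<open>N_index \<alpha> r - 1\<close> is meaningful only then.\<close>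

definition k_index :: "real \<Rightarrow> real \<Rightarrow> int" where
  "k_index \<alpha> r =
     - \<lfloor>(eps \<alpha> r - cf_d \<alpha> (N_index \<alpha> r - 1)) / cf_d \<alpha> (N_index \<alpha> r)\<rfloor>"

definition A_param :: "real \<Rightarrow> real \<Rightarrow> real" where
  "A_param \<alpha> r = 1 - cf_d \<alpha> (N_index \<alpha> r) / eps \<alpha> r"

definition B_param :: "real \<Rightarrow> real \<Rightarrow> real" where
  "B_param \<alpha> r =
     1 - (cf_d \<alpha> (N_index \<alpha> r - 1) - of_int (k_index \<alpha> r) * cf_d \<alpha> (N_index \<alpha> r)) / eps \<alpha> r"

definition Q_param :: "real \<Rightarrow> real \<Rightarrow> real" where
  "Q_param \<alpha> r = eps \<alpha> r * of_int (cf_q \<alpha> (N_index \<alpha> r))"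


section \<open>The explicit transfer map\<close>

text \<open>Only the parity of \<open>N\<close> matters. The formula is not restricted to parameters in
  \<open>]0,1[\<^sup>3\<close>: at exceptional radii \<open>A_param\<close> or \<open>B_param\<close> vanishes, and then the corresponding
  case is void for \<open>h \<in> ]-1,1[\<close>. For \<open>A + B \<le> 1\<close>, which holds for the parameters above, the
  three intervals form a partition of \<open>[-1,1]\<close>.\<close>

definition explicit_transfer :: "real \<Rightarrow> real \<Rightarrow> real \<Rightarrow> nat \<Rightarrow> real \<Rightarrow> real \<times> real" where
  "explicit_transfer A B Q N h =
     (let Q' = (1 - Q * (1 - B)) / (1 - A) in
      if (-1) ^ N * h \<in> {1 - 2 * A <.. 1} then (Q, h - 2 * (-1) ^ N * (1 - A))
      else if (-1) ^ N * h \<in> {-1 ..< -1 + 2 * B} then (Q', h + 2 * (-1) ^ N * (1 - B))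
      else if (-1) ^ N * h \<in> {-1 + 2 * B .. 1 - 2 * A} then (Q' + Q, h + 2 * (-1) ^ N * (A - B))
      else undefined)"

end

theory Submission
  imports Defs
begin

text \<open>In the frame of \<open>\<omega>\<close>, a particle leaving the obstacle at \<open>0\<close> with impact parameter \<open>h\<close>
  touches the obstacle at \<open>(q, p)\<close> iff \<open>g = h + 2 (q \<alpha> - p) / \<epsilon>\<close> satisfies \<open>\<bar>g\<bar> \<le> 1\<close>, and
  \<open>g\<close> is then the next impact parameter. Among these obstacles the first one met is that with
  the least \<open>q > 0\<close>, so \<open>q\<close> is the first return time of a rotation by \<open>\<alpha>\<close> to a window of
  length \<open>\<epsilon>\<close>. By the three-gap theorem it is \<open>q\<^sub>N\<close>, \<open>q\<^sub>N\<^sub>-\<^sub>1 + k q\<^sub>N\<close> or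
  their sum. The flight has length \<open>q / cos \<theta> + O(r)\<close>, which the factor \<open>2 r\<close> turns into
  \<open>\<epsilon> q + O(r\<^sup>2)\<close>.\<close>

section \<open>Obstacles and the phase space\<close>

lemma lattice_diff: "c \<in> lattice \<Longrightarrow> c' \<in> lattice \<Longrightarrow> c - c' \<in> lattice"
  unfolding lattice_def
  by (clarsimp simp: complex_eq_iff) (metis of_int_diff)

lemma lattice_add: "c \<in> lattice \<Longrightarrow> c' \<in> lattice \<Longrightarrow> c + c' \<in> lattice"
  unfolding lattice_def
  by (clarsimp simp: complex_eq_iff) (metis of_int_add)

lemma zero_in_lattice: "0 \<in> lattice"
  unfolding lattice_def by (auto simp: complex_eq_iff intro: exI[of _ 0])

lemma dist_lattice_ge_1:
  assumes "c \<in> lattice" "c' \<in> lattice" "c \<noteq> c'"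
  shows "1 \<le> dist c c'"
proof -
  have "c - c' \<in> lattice" using assms lattice_diff by blast
  then obtain m n :: int where mn: "c - c' = Complex (of_int m) (of_int n)"
    unfolding lattice_def by blast
  have "m \<noteq> 0 \<or> n \<noteq> 0" using mn assms(3) by (auto simp: complex_eq_iff)
  then have "1 \<le> m\<^sup>2 + n\<^sup>2"
    by (smt (verit) zero_less_power2 zero_le_power2)
  then have "1 \<le> (of_int m)\<^sup>2 + (of_int n :: real)\<^sup>2"
    by (metis of_int_1 of_int_add of_int_le_iff of_int_power)
  then show ?thesis by (simp add: dist_norm mn complex_norm)
qed

lemma closed_lattice: "closed lattice"
  by (rule discrete_imp_closed[of 1]) (use dist_lattice_ge_1 in \<open>force simp: dist_norm\<close>)+

text \<open>Distinct lattice points are at least 1 apart and \<open>r < 1/2\<close>, so by the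
  triangle inequality a lattice point at distance \<open>r\<close> is the nearest one.\<close>

lemma infdist_lattice_eq_iff:
  assumes "0 < r" "r < 1/2"
  shows "infdist x lattice = r \<longleftrightarrow> (\<exists>c\<in>lattice. dist x c = r)"
proof
  assume "infdist x lattice = r"
  then show "\<exists>c\<in>lattice. dist x c = r"
    by (metis closed_lattice empty_iff infdist_attains_inf zero_in_lattice)
next
  assume "\<exists>c\<in>lattice. dist x c = r"
  then obtain c where c: "c \<in> lattice" "dist x c = r" by blast
  obtain c' where c': "c' \<in> lattice" "dist x c' = infdist x lattice"
    by (metis closed_lattice empty_iff infdist_attains_inf zero_in_lattice)
  have le: "dist x c' \<le> r" using c c' infdist_le by metis
  have "c = c'"
  proof (rule ccontr)
    assume "c \<noteq> c'"
    then have "1 \<le> dist c c'" using c c' dist_lattice_ge_1 by blast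
    then show False using le c assms dist_triangle3[of c c' x] by linarith
  qed
  then show "infdist x lattice = r" using c c' by simp
qed

lemma frontier_billiard_table:
  assumes r: "0 < r" "r < 1/2"
  shows "x \<in> frontier (billiard_table r) \<longleftrightarrow> (\<exists>c\<in>lattice. dist x c = r)"
proof -
  have cont: "continuous_on UNIV (\<lambda>x. infdist x lattice)"
    by (intro continuous_intros)
  have op: "open (billiard_table r)"
    unfolding billiard_table_def by (intro open_Collect_less cont continuous_intros)
  have "closed {x. r \<le> infdist x lattice}"
    by (intro closed_Collect_le cont continuous_intros)
  then have cl: "closure (billiard_table r) \<subseteq> {x. r \<le> infdist x lattice}"
    by (intro closure_minimal) (auto simp: billiard_table_def)
  have fr: "frontier (billiard_table r) = closure (billiard_table r) - billiard_table r"
    using op by (simp add: frontier_def interior_open)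
  show ?thesis
  proof
    assume "x \<in> frontier (billiard_table r)"
    then have "infdist x lattice = r" using fr cl by (force simp: billiard_table_def)
    then show "\<exists>c\<in>lattice. dist x c = r" using infdist_lattice_eq_iff[OF r] by blast
  next
    assume "\<exists>c\<in>lattice. dist x c = r"
    then obtain c where c: "c \<in> lattice" "dist x c = r" by blast
    then have notin: "x \<notin> billiard_table r"
      using infdist_lattice_eq_iff[OF r] by (force simp: billiard_table_def)
    have "x \<in> closure (billiard_table r)"
    proof (subst closure_approachable, intro allI impI)
      fix e :: real assume e: "0 < e"
      \<comment> \<open>Pushing \<open>x\<close> radially out to radius \<open>s\<close> enters the
        table. The radius exceeds \<open>r\<close> by less than \<open>e\<close> and stays below
        1/2, so that the distance to the lattice is again read off from the single centre
        \<open>c\<close>.\<close>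
      define s where "s = r + min e (1/2 - r) / 2"
      have s: "r < s" "s < 1/2" "s - r < e" using e r by (auto simp: s_def min_def field_simps)
      define y where "y = c + (s / r) *\<^sub>R (x - c)"
      have yc: "dist y c = s"
        using c s r by (simp add: y_def dist_norm)
      have "y - x = ((s - r) / r) *\<^sub>R (x - c)"
        using r by (simp add: y_def diff_divide_distrib algebra_simps)
      then have yx: "dist y x = s - r"
        using c s r by (simp add: dist_norm)
      have "infdist y lattice = s"
        using infdist_lattice_eq_iff[of s y] s r c(1) yc by auto
      then have "y \<in> billiard_table r" using s by (simp add: billiard_table_def)
      then show "\<exists>y\<in>billiard_table r. dist y x < e" using yx s by (intro bexI[of _ y]) auto
    qed
    then show "x \<in> frontier (billiard_table r)" using notin fr by blast
  qed
qed

lemma obstacle_centre_eq: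
  assumes "r < 1/2" "c \<in> lattice" "dist x c = r"
  shows "obstacle_centre r x = c"
  unfolding obstacle_centre_def
proof (rule the_equality)
  fix c' assume c': "c' \<in> lattice \<and> dist x c' = r"
  show "c' = c"
  proof (rule ccontr)
    assume "c' \<noteq> c"
    then have "1 \<le> dist c' c" using assms c' dist_lattice_ge_1 by blast
    then show False using c' assms dist_triangle3[of c' c x] by linarith
  qed
qed (use assms in auto)

lemma unit_normal_eq:
  assumes "0 < r" "r < 1/2" "c \<in> lattice" "norm n = 1"
  shows "unit_normal r (c + r *\<^sub>R n) = n"
proof -
  have "obstacle_centre r (c + r *\<^sub>R n) = c"
    by (rule obstacle_centre_eq) (use assms in \<open>auto simp: dist_norm\<close>)
  then show ?thesis using assms by (simp add: unit_normal_def)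
qed

section \<open>Outgoing states and representatives of their classes\<close>

lemma norm_Complex_eq_1: "a\<^sup>2 + b\<^sup>2 = 1 \<Longrightarrow> norm (Complex a b) = 1"
  by (simp add: complex_norm)

text \<open>Writing the normal as \<open>v * Complex a b\<close> puts it in the frame of the
  velocity: \<open>a\<close> and \<open>b\<close> are the cosine and the sine of the oriented angle
  from \<open>v\<close> to the normal. Later states are kept in this form.\<close>

lemma impact_eq:
  assumes "0 < r" "r < 1/2" "c \<in> lattice" "norm v = 1" "a\<^sup>2 + b\<^sup>2 = 1"
  shows "impact r (c + r *\<^sub>R (v * Complex a b), v) = b"
proof -
  have "v \<noteq> 0" "norm (Complex a b) = 1"
    using assms norm_Complex_eq_1 by auto
  moreover have "unit_normal r (c + r *\<^sub>R (v * Complex a b)) = v * Complex a b"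
    by (rule unit_normal_eq) (use assms calculation in \<open>auto simp: norm_mult\<close>)
  moreover have "Complex a b = cis (Arg (Complex a b))"
    using calculation(2) by (metis norm_zero zero_neq_one cis_Arg div_by_1 divide_complex_def sgn_eq of_real_1)
  then have "sin (Arg (Complex a b)) = b"
    by (metis Im_i_times cis.sel(2) complex.sel(2))
  ultimately show ?thesis by (simp add: impact_def)
qed

lemma inner_mult_unit:
  fixes v :: complex
  assumes "norm v = 1"
  shows "v \<bullet> (v * Complex a b) = a"
proof -
  have "(Re v)\<^sup>2 + (Im v)\<^sup>2 = 1" using assms by (simp add: norm_complex_def)
  then have "a * ((Re v)\<^sup>2 + (Im v)\<^sup>2) = a" by simp
  then show ?thesis by (simp add: inner_complex_def power2_eq_square algebra_simps)
qed

lemma Gamma_plusI: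
  assumes "0 < r" "r < 1/2" "c \<in> lattice" "norm v = 1" "a\<^sup>2 + b\<^sup>2 = 1" "0 < a"
  shows "(c + r *\<^sub>R (v * Complex a b), v) \<in> Gamma_plus r"
proof -
  have n: "norm (v * Complex a b) = 1" using assms norm_Complex_eq_1 by (auto simp: norm_mult)
  then have "c + r *\<^sub>R (v * Complex a b) \<in> frontier (billiard_table r)"
    using assms frontier_billiard_table by (auto simp: dist_norm intro!: bexI[of _ c])
  then show ?thesis
    using assms n by (simp add: Gamma_plus_def unit_normal_eq inner_mult_unit)
qed

lemma Gamma_plusE:
  assumes "0 < r" "r < 1/2" "(x, v) \<in> Gamma_plus r"
  obtains c a b where "c \<in> lattice" "norm v = 1" "a\<^sup>2 + b\<^sup>2 = 1" "0 < a"
    "x = c + r *\<^sub>R (v * Complex a b)"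
proof -
  have v: "norm v = 1" "0 < v \<bullet> unit_normal r x" and x: "x \<in> frontier (billiard_table r)"
    using assms by (auto simp: Gamma_plus_def)
  obtain c where c: "c \<in> lattice" "dist x c = r"
    using x frontier_billiard_table assms by blast
  have norm_v: "v \<noteq> 0" using v by auto
  define z where "z = inverse v * ((x - c) /\<^sub>R r)"
  have nz: "norm z = 1" using c assms v by (simp add: z_def norm_mult norm_inverse dist_norm)
  have "v * z = (x - c) /\<^sub>R r" using norm_v by (simp add: z_def flip: mult.assoc)
  then have x: "x = c + r *\<^sub>R (v * Complex (Re z) (Im z))"
    using assms by (simp add: complex_surj)
  have "(Re z)\<^sup>2 + (Im z)\<^sup>2 = 1" using nz by (simp add: norm_complex_def)
  moreover have "unit_normal r x = v * Complex (Re z) (Im z)"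
    unfolding x by (rule unit_normal_eq) (use assms c v nz in \<open>auto simp: norm_mult\<close>)
  then have "0 < Re z" using v inner_mult_unit by metis
  ultimately show ?thesis using that c v x by blast
qed

lemma impact_translate:
  assumes "0 < r" "r < 1/2" "(x, v) \<in> Gamma_plus r" "l \<in> lattice"
  shows "impact r (x + l, v) = impact r (x, v)"
  using assms(3)
proof (rule Gamma_plusE[OF assms(1,2)])
  fix c a b
  assume *: "c \<in> lattice" "norm v = 1" "a\<^sup>2 + b\<^sup>2 = 1" "x = c + r *\<^sub>R (v * Complex a b)"
  have "x + l = (c + l) + r *\<^sub>R (v * Complex a b)" using * by simp
  then show ?thesis
    using * impact_eq[OF assms(1,2)] lattice_add assms(4) by metis
qed

text \<open>Lattice translations leave the impact parameter unchanged, so the image of a class is a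
  singleton and \<open>the_elem\<close> returns its element.\<close>

lemma impact_class_eq:
  assumes "0 < r" "r < 1/2" "p \<in> Gamma_plus r"
  shows "impact_class r (lattice_equiv r `` {p}) = (impact r p, snd p)"
proof -
  obtain x v where p: "p = (x, v)" by (cases p)
  have "(case z of (x, \<omega>) \<Rightarrow> (impact r (x, \<omega>), \<omega>)) = (impact r p, snd p)"
    if z: "z \<in> lattice_equiv r `` {p}" for z
  proof -
    obtain y where "z = (y, v)" "y - x \<in> lattice"
      using z by (auto simp: lattice_equiv_def p)
    then show ?thesis
      using impact_translate[OF assms(1,2), of x v "y - x"] assms(3) by (simp add: p)
  qed
  moreover have "p \<in> lattice_equiv r `` {p}"
    using assms(3) zero_in_lattice by (auto simp: lattice_equiv_def p)
  ultimately have "(\<lambda>(x, \<omega>). (impact r (x, \<omega>), \<omega>)) ` (lattice_equiv r `` {p}) = {(impact r p, snd p)}"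
    by (auto simp: image_iff)
  then show ?thesis by (simp add: impact_class_def)
qed

text \<open>The choices in \<open>Y\<close> and \<open>Y_rep\<close> leave only a lattice
  translation open: the impact parameter fixes the sine of the angle, and being outgoing fixes the
  sign of its cosine.\<close>

lemma Y_rep_eq:
  assumes r: "0 < r" "r < 1/2" and v: "norm v = 1" and h: "\<bar>h\<bar> < 1"
  obtains c where "c \<in> lattice"
    "Y_rep r (h, v) = (c + r *\<^sub>R (v * Complex (sqrt (1 - h\<^sup>2)) h), v)"
proof -
  have h2: "0 < 1 - h\<^sup>2" using h by (simp add: abs_square_less_1)
  then have ab: "(sqrt (1 - h\<^sup>2))\<^sup>2 + h\<^sup>2 = 1" "0 < sqrt (1 - h\<^sup>2)" by auto
  \<comment> \<open>A state on the obstacle at 0; it puts \<open>(h, v)\<close> into the range of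
    \<open>impact_class\<close>, so that \<open>inv_into\<close> yields a true preimage.\<close>
  define p0 where "p0 = (0 + r *\<^sub>R (v * Complex (sqrt (1 - h\<^sup>2)) h), v)"
  have p0: "p0 \<in> Gamma_plus r" "impact r p0 = h" "snd p0 = v"
    unfolding p0_def
    using Gamma_plusI[OF r zero_in_lattice v ab] impact_eq[OF r zero_in_lattice v ab(1)]
    by simp_all
  then have "(h, v) \<in> impact_class r ` Gamma_plus_mod r"
    using impact_class_eq[OF r p0(1)] unfolding Gamma_plus_mod_def
    by (metis image_eqI quotientI)
  then have Y: "Y r (h, v) \<in> Gamma_plus_mod r" "impact_class r (Y r (h, v)) = (h, v)"
    unfolding Y_def by (auto intro: inv_into_into f_inv_into_f)
  then obtain p1 where p1: "p1 \<in> Gamma_plus r" "Y r (h, v) = lattice_equiv r `` {p1}"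
    unfolding Gamma_plus_mod_def by (meson quotientE)
  have "p1 \<in> Y r (h, v)"
    using p1 zero_in_lattice by (cases p1) (auto simp: lattice_equiv_def)
  then have "Y_rep r (h, v) \<in> Y r (h, v)"
    unfolding Y_rep_def by (rule someI)
  then have rep: "Y_rep r (h, v) \<in> Gamma_plus r" "(p1, Y_rep r (h, v)) \<in> lattice_equiv r"
    using p1 by (auto simp: lattice_equiv_def)
  have p1v: "impact r p1 = h" "snd p1 = v"
    using impact_class_eq[OF r p1(1)] Y p1 by auto
  obtain x where x: "Y_rep r (h, v) = (x, v)"
    using rep p1v by (auto simp: lattice_equiv_def)
  obtain x1 where x1: "p1 = (x1, v)" using p1v by (cases p1) auto
  have "impact r (x, v) = h"
    using impact_translate[OF r, of x1 v "x - x1"] rep p1 p1v unfolding x x1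
    by (auto simp: lattice_equiv_def)
  moreover have "(x, v) \<in> Gamma_plus r" using rep x by simp
  ultimately obtain c a b where c: "c \<in> lattice" "a\<^sup>2 + b\<^sup>2 = 1" "0 < a"
    "x = c + r *\<^sub>R (v * Complex a b)" "impact r (x, v) = h"
    using Gamma_plusE[OF r] by metis
  have "b = h" using c impact_eq[OF r c(1) v c(2)] by simp
  moreover have "a = sqrt (1 - h\<^sup>2)"
    using c calculation by (intro real_sqrt_unique[symmetric]) auto
  ultimately show ?thesis using that c x by blast
qed

section \<open>Continued fractions and first returns\<close>

lemma cf_d_Suc: "cf_d \<alpha> (Suc (Suc n)) = cf_d \<alpha> n - of_int (cf_digit \<alpha> (Suc n)) * cf_d \<alpha> (Suc n)"
  by (simp add: cf_d_def algebra_simps)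

text \<open>Ratios of successive errors satisfy the recursion of the remainders, so each error is a
  product of numbers in ]0,1[. Positivity and monotonicity are read off from this product.\<close>

lemma cf_d_Suc_eq_mult:
  assumes "\<alpha> \<notin> \<rat>" "0 < \<alpha>" "\<alpha> < 1"
  shows "cf_d \<alpha> (Suc n) = cf_d \<alpha> n * cf_rem \<alpha> n"
proof (induction n)
  case 0
  then show ?case by (simp add: cf_d_def)
next
  case (Suc n)
  have "cf_rem \<alpha> n * (of_int (cf_digit \<alpha> (Suc n)) + cf_rem \<alpha> (Suc n)) = 1"
    using cf_expansion(2)[OF assms, of n] by (subst cf_expansion(5)[OF assms]) (auto simp: cf_digit_def frac_def)
  then have "cf_rem \<alpha> n * cf_rem \<alpha> (Suc n) = 1 - of_int (cf_digit \<alpha> (Suc n)) * cf_rem \<alpha> n"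
    by (simp add: algebra_simps)
  then have "cf_d \<alpha> n * (cf_rem \<alpha> n * cf_rem \<alpha> (Suc n)) =
      cf_d \<alpha> n * (1 - of_int (cf_digit \<alpha> (Suc n)) * cf_rem \<alpha> n)" by metis
  then show ?case
    using Suc by (simp only: cf_d_Suc) (simp add: algebra_simps)
qed

lemma cf_d_pos:
  assumes "\<alpha> \<notin> \<rat>" "0 < \<alpha>" "\<alpha> < 1"
  shows "0 < cf_d \<alpha> n"
proof (induction n)
  case 0
  then show ?case by (simp add: cf_d_def)
next
  case (Suc n)
  then show ?case using cf_expansion(2)[OF assms, of n] by (simp add: cf_d_Suc_eq_mult[OF assms])
qed

lemma cf_d_decreasing:
  assumes "\<alpha> \<notin> \<rat>" "0 < \<alpha>" "\<alpha> < 1"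
  shows "cf_d \<alpha> (Suc n) < cf_d \<alpha> n"
  using cf_d_pos[OF assms, of n] cf_expansion(3)[OF assms, of n]
  by (simp add: cf_d_Suc_eq_mult[OF assms])

text \<open>Digits are at least 1, so d_(n+2) \<le> d_n - d_(n+1); adding d_(n+2) < d_(n+1) gives
  the factor 1/2. Hence the errors tend to 0, which makes the set in \<open>N_index\<close>
  nonempty.\<close>

lemma cf_d_halves:
  assumes "\<alpha> \<notin> \<rat>" "0 < \<alpha>" "\<alpha> < 1"
  shows "cf_d \<alpha> (Suc (Suc n)) \<le> cf_d \<alpha> n / 2"
proof -
  have "1 * cf_d \<alpha> (Suc n) \<le> of_int (cf_digit \<alpha> (Suc n)) * cf_d \<alpha> (Suc n)"
    by (intro mult_right_mono) (use cf_d_pos[OF assms, of "Suc n"] cf_expansion(4)[OF assms, of n] in \<open>auto simp: int_one_le_iff_zero_less\<close>)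
  then show ?thesis
    using cf_d_Suc[of \<alpha> n] cf_d_decreasing[OF assms, of "Suc n"] by linarith
qed

lemma ex_cf_d_le:
  assumes "\<alpha> \<notin> \<rat>" "0 < \<alpha>" "\<alpha> < 1" "0 < e"
  shows "\<exists>n. cf_d \<alpha> n \<le> e"
proof -
  have le: "cf_d \<alpha> (2 * n) \<le> (1/2) ^ n" for n
  proof (induction n)
    case 0
    then show ?case by (simp add: cf_d_def)
  next
    case (Suc n)
    then show ?case using cf_d_halves[OF assms(1-3), of "2 * n"] by simp
  qed
  obtain n where "(1/2 :: real) ^ n < e" using real_arch_pow_inv[of e "1/2"] assms by auto
  then show ?thesis using le[of n] by (meson order.strict_implies_order order_trans)
qed

lemma cf_q_pos:
  assumes "\<alpha> \<notin> \<rat>" "0 < \<alpha>" "\<alpha> < 1"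
  shows "0 \<le> cf_q \<alpha> n" "0 < cf_q \<alpha> (Suc n)"
proof -
  have "0 \<le> cf_q \<alpha> n \<and> 0 < cf_q \<alpha> (Suc n)"
  proof (induction n)
    case (Suc n)
    then show ?case using cf_expansion(4)[OF assms, of n] by (simp add: add_pos_nonneg)
  qed auto
  then show "0 \<le> cf_q \<alpha> n" "0 < cf_q \<alpha> (Suc n)" by auto
qed

text \<open>Each step of the recurrence flips the sign of the determinant. Consecutive vectors (q_n,
  p_n) are thus a basis of the integer lattice, as the first-return argument requires.\<close>

lemma cf_det: "cf_q \<alpha> (Suc n) * cf_p \<alpha> n - cf_q \<alpha> n * cf_p \<alpha> (Suc n) = (-1) ^ n"
  by (induction n) (auto simp: algebra_simps)

section \<open>The stopping index and first returns to the window\<close>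

text \<open>Since d_0 = 1 exceeds \<open>eps \<alpha> r\<close>, the infimum is not 0, and its
  predecessor lies outside the set by minimality. Naming that predecessor \<open>m\<close> makes the
  truncated subtraction in \<open>k_index\<close> and \<open>B_param\<close> exact.\<close>

lemma N_index_props:
  assumes "\<alpha> \<notin> \<rat>" "0 < \<alpha>" "\<alpha> < 1" "0 < eps \<alpha> r" "eps \<alpha> r < 1"
  obtains m where "N_index \<alpha> r = Suc m" "cf_d \<alpha> (Suc m) \<le> eps \<alpha> r" "eps \<alpha> r < cf_d \<alpha> m"
proof -
  have ex: "\<exists>n. cf_d \<alpha> n \<le> eps \<alpha> r" using ex_cf_d_le assms by blast
  have le: "cf_d \<alpha> (N_index \<alpha> r) \<le> eps \<alpha> r"
    unfolding N_index_def using ex Inf_nat_def1[of "{n. cf_d \<alpha> n \<le> eps \<alpha> r}"] by auto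
  have "N_index \<alpha> r \<noteq> 0"
  proof
    assume "N_index \<alpha> r = 0"
    then show False using le assms by (simp add: cf_d_def)
  qed
  then obtain m where m: "N_index \<alpha> r = Suc m" using not0_implies_Suc by blast
  then have "m \<notin> {n. cf_d \<alpha> n \<le> eps \<alpha> r}"
    unfolding N_index_def by (intro notI) (drule cInf_lower[OF _ bdd_below_bot], simp)
  then show ?thesis using that m le by auto
qed

text \<open>A three-gap argument: the two vectors form a basis of the integer lattice, and a
  combination with coefficients of opposite signs moves by at least \<open>u + v > \<epsilon>\<close>, so it leaves
  the window of length \<open>\<epsilon>\<close>.\<close>

lemma first_return:
  fixes \<delta> :: "int \<Rightarrow> int \<Rightarrow> real" and q\<^sub>1 p\<^sub>1 q\<^sub>2 p\<^sub>2 :: int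
  assumes \<delta>: "\<And>a b q p q' p'. \<delta> (a * q + b * q') (a * p + b * p') = of_int a * \<delta> q p + of_int b * \<delta> q' p'"
    and det: "\<bar>q\<^sub>1 * p\<^sub>2 - q\<^sub>2 * p\<^sub>1\<bar> = 1"
    and pos: "0 < q\<^sub>1" "0 < q\<^sub>2"
    and u: "\<delta> q\<^sub>1 p\<^sub>1 = - u" "0 < u" "u \<le> \<epsilon>"
    and v: "\<delta> q\<^sub>2 p\<^sub>2 = v" "0 < v" "v \<le> \<epsilon>"
    and uv: "\<epsilon> < u + v"
    and w: "0 \<le> w" "w \<le> \<epsilon>"
    and qp: "(q, p) = (if u \<le> w then (q\<^sub>1, p\<^sub>1) else if v \<le> \<epsilon> - w then (q\<^sub>2, p\<^sub>2) else (q\<^sub>1 + q\<^sub>2, p\<^sub>1 + p\<^sub>2))"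
  shows "0 < q" "- w \<le> \<delta> q p" "\<delta> q p \<le> \<epsilon> - w"
    and "\<And>q' p'. 0 < q' \<Longrightarrow> - w \<le> \<delta> q' p' \<Longrightarrow> \<delta> q' p' \<le> \<epsilon> - w \<Longrightarrow> q \<le> q'"
proof -
  have sum: "\<delta> (q\<^sub>1 + q\<^sub>2) (p\<^sub>1 + p\<^sub>2) = v - u"
    using \<delta>[of 1 q\<^sub>1 1 q\<^sub>2 p\<^sub>1 p\<^sub>2] u v by simp
  show "0 < q" "- w \<le> \<delta> q p" "\<delta> q p \<le> \<epsilon> - w"
    using qp pos u v uv w sum by (auto split: if_splits)
  fix q' p' assume q': "0 < q'" and l: "- w \<le> \<delta> q' p'" "\<delta> q' p' \<le> \<epsilon> - w"
  \<comment> \<open>Coordinates of \<open>(q', p')\<close> in the basis by Cramer's rule; as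
    \<open>D\<close> is 1 or -1, dividing by it is multiplying by it.\<close>
  define D where "D = q\<^sub>1 * p\<^sub>2 - q\<^sub>2 * p\<^sub>1"
  define a where "a = D * (q' * p\<^sub>2 - p' * q\<^sub>2)"
  define b where "b = D * (q\<^sub>1 * p' - p\<^sub>1 * q')"
  have DD: "D * D = 1" using det by (metis D_def abs_mult_self_eq mult_1)
  have "a * q\<^sub>1 + b * q\<^sub>2 = D * D * q'" "a * p\<^sub>1 + b * p\<^sub>2 = D * D * p'"
    by (simp_all add: a_def b_def D_def algebra_simps)
  then have ab: "q' = a * q\<^sub>1 + b * q\<^sub>2" "p' = a * p\<^sub>1 + b * p\<^sub>2" using DD by auto
  then have d: "\<delta> q' p' = - of_int a * u + of_int b * v" using \<delta> u v by simp
  have mono: "c * x \<le> d * x" if "c \<le> d" "0 < x" for c d :: int and x using that by simp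
  have rmono: "of_int c * x \<le> of_int d * x" if "c \<le> d" "0 < x" for c d :: int and x :: real
    using that by simp
  \<comment> \<open>Two nonpositive coefficients contradict \<open>0 < q'\<close>; two positive ones
    give at least \<open>q\<^sub>1 + q\<^sub>2\<close>, the largest candidate. In the mixed cases
    the window forces the nonpositive coefficient to vanish.\<close>
  consider "a \<le> 0" "b \<le> 0" | "1 \<le> a" "1 \<le> b" | "1 \<le> a" "b \<le> 0" | "a \<le> 0" "1 \<le> b" by linarith
  then show "q \<le> q'"
  proof cases
    case 1
    then show ?thesis using q' ab(1) mono[of a 0 q\<^sub>1] mono[of b 0 q\<^sub>2] pos by simp
  next
    case 2
    then have "1 * q\<^sub>1 \<le> a * q\<^sub>1" "1 * q\<^sub>2 \<le> b * q\<^sub>2" using mono pos by blast+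
    moreover have "q \<le> q\<^sub>1 + q\<^sub>2" using qp pos by (auto split: if_splits)
    ultimately show ?thesis unfolding ab(1) by linarith
  next
    case 3
    have au: "u \<le> of_int a * u" using rmono[of 1 a u] 3 u(2) by (simp only: of_int_1 mult_1)
    have "b = 0"
    proof (rule ccontr)
      assume "b \<noteq> 0"
      then have "of_int b * v \<le> of_int (- 1) * v" using 3 v(2) by (intro rmono) auto
      then have "of_int b * v \<le> - v" by simp
      then show False using d l(1) au uv w by linarith
    qed
    moreover have "u \<le> w" using calculation d l(1) au by simp
    moreover have "1 * q\<^sub>1 \<le> a * q\<^sub>1" using mono 3 pos by blast
    ultimately show ?thesis unfolding ab(1) using qp by simp
  next
    case 4
    have bv: "v \<le> of_int b * v" using rmono[of 1 b v] 4 v(2) by (simp only: of_int_1 mult_1)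
    have "a = 0"
    proof (rule ccontr)
      assume "a \<noteq> 0"
      then have "of_int a * u \<le> of_int (- 1) * u" using 4 u(2) by (intro rmono) auto
      then have "of_int a * u \<le> - u" by simp
      then show False using d l(2) bv uv w by linarith
    qed
    moreover have "v \<le> \<epsilon> - w" using calculation d l(2) bv by simp
    \<comment> \<open>The tests \<open>u \<le> w\<close> and \<open>v \<le> \<epsilon> - w\<close>
      exclude each other because \<open>u + v\<close> exceeds \<open>\<epsilon>\<close>.\<close>
    moreover have "\<not> u \<le> w" using calculation uv by linarith
    moreover have "1 * q\<^sub>2 \<le> b * q\<^sub>2" using mono 4 pos by blast
    ultimately show ?thesis unfolding ab(1) using qp by simp
  qed
qed

text \<open>The strict inequality in the last clause excludes a grazing first collision, where the closed
  window of the flight and the half-open intervals of \<open>explicit_transfer\<close> disagree.\<close>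

lemma explicit_transfer_first_return:
  assumes \<alpha>: "\<alpha> \<notin> \<rat>" "0 < \<alpha>" "\<alpha> < 1" and e: "0 < eps \<alpha> r" "eps \<alpha> r < 1"
    and h: "\<bar>h\<bar> < 1"
  obtains q p :: int where "0 < q"
    "\<bar>h + 2 * (of_int q * \<alpha> - of_int p) / eps \<alpha> r\<bar> \<le> 1"
    "\<forall>q' p' :: int. 0 < q' \<longrightarrow> \<bar>h + 2 * (of_int q' * \<alpha> - of_int p') / eps \<alpha> r\<bar> \<le> 1 \<longrightarrow> q \<le> q'"
    "\<bar>h + 2 * (of_int q * \<alpha> - of_int p) / eps \<alpha> r\<bar> < 1 \<longrightarrow>
      explicit_transfer (A_param \<alpha> r) (B_param \<alpha> r) (Q_param \<alpha> r) (N_index \<alpha> r) h =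
        (eps \<alpha> r * of_int q, h + 2 * (of_int q * \<alpha> - of_int p) / eps \<alpha> r)"
proof -
  define \<epsilon> where "\<epsilon> = eps \<alpha> r"
  have \<epsilon>: "0 < \<epsilon>" using e by (simp add: \<epsilon>_def)
  obtain m where m: "N_index \<alpha> r = Suc m" "cf_d \<alpha> (Suc m) \<le> \<epsilon>" "\<epsilon> < cf_d \<alpha> m"
    using N_index_props[OF \<alpha> e] unfolding \<epsilon>_def by metis
  define k where "k = k_index \<alpha> r"
  define u where "u = cf_d \<alpha> (Suc m)"
  define v where "v = cf_d \<alpha> m - of_int k * u"
  define q\<^sub>1 where "q\<^sub>1 = cf_q \<alpha> (Suc m)"
  define p\<^sub>1 where "p\<^sub>1 = cf_p \<alpha> (Suc m)"
  \<comment> \<open>An intermediate convergent: adding \<open>k\<close> times the vector of index N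
    to that of index N - 1 lowers the error to \<open>v\<close> and keeps the determinant.\<close>
  define q\<^sub>2 where "q\<^sub>2 = cf_q \<alpha> m + k * q\<^sub>1"
  define p\<^sub>2 where "p\<^sub>2 = cf_p \<alpha> m + k * p\<^sub>1"
  \<comment> \<open>This is (-1)^N. Convergents approximate from alternating sides; with this sign
    \<open>\<delta>\<close> is \<open>- u\<close> on the vector of index N and
    \<open>cf_d \<alpha> m\<close> on that of index N - 1, for either parity.\<close>
  define \<sigma> :: real where "\<sigma> = (-1) ^ Suc m"
  define \<delta> where "\<delta> q p = \<sigma> * (of_int q * \<alpha> - of_int p)" for q p :: int
  \<comment> \<open>Position of \<open>\<sigma> * h\<close> after rescaling [-1,1] to a window
    [0, \<open>\<epsilon>\<close>], in which a flight is a move by \<open>\<delta>\<close>.\<close>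
  define w where "w = (1 + \<sigma> * h) / 2 * \<epsilon>"
  have \<sigma>: "\<sigma> = 1 \<or> \<sigma> = -1" "\<sigma> * \<sigma> = 1" unfolding \<sigma>_def by (cases "even m"; simp)+
  have u: "0 < u" "u \<le> \<epsilon>" using cf_d_pos[OF \<alpha>] m by (auto simp: u_def)
  \<comment> \<open>The floor makes \<open>k\<close> the least integer with d_(N-1) - k d_N \<le>
    \<epsilon>. This gives \<open>v \<le> \<epsilon>\<close> and \<open>\<epsilon> < u + v\<close>,
    hence \<open>0 < v\<close> by \<open>u \<le> \<epsilon>\<close>; and \<open>0 < k\<close>
    because d_(N-1) exceeds \<epsilon>.\<close>
  have keq: "k = - \<lfloor>(\<epsilon> - cf_d \<alpha> m) / u\<rfloor>" by (simp add: k_def k_index_def m(1) u_def \<epsilon>_def)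
  then have "of_int (- k) \<le> (\<epsilon> - cf_d \<alpha> m) / u" "(\<epsilon> - cf_d \<alpha> m) / u < of_int (- k) + 1"
    by linarith+
  then have k: "- of_int k * u \<le> \<epsilon> - cf_d \<alpha> m" "\<epsilon> - cf_d \<alpha> m < (- of_int k + 1) * u"
    using u by (simp_all add: pos_le_divide_eq pos_divide_less_eq)
  have "0 < k"
  proof (rule ccontr)
    assume "\<not> 0 < k"
    then have "0 \<le> - real_of_int k * u" using u by (intro mult_nonneg_nonneg) auto
    then show False using k m by linarith
  qed
  have v: "v \<le> \<epsilon>" "\<epsilon> < u + v" "0 < v"
    using k u by (auto simp: v_def algebra_simps)
  have q: "0 < q\<^sub>1" "0 < q\<^sub>2"
    using cf_q_pos[OF \<alpha>, of m] \<open>0 < k\<close> by (auto simp: q\<^sub>1_def q\<^sub>2_def add_nonneg_pos)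
  have lin: "\<delta> (a * q + b * q') (a * p + b * p') = of_int a * \<delta> q p + of_int b * \<delta> q' p'" for a b q p q' p'
    by (simp add: \<delta>_def algebra_simps)
  have \<delta>1: "\<delta> q\<^sub>1 p\<^sub>1 = - u"
    by (simp add: \<delta>_def \<sigma>_def u_def q\<^sub>1_def p\<^sub>1_def cf_d_def)
  have \<delta>0: "\<delta> (cf_q \<alpha> m) (cf_p \<alpha> m) = cf_d \<alpha> m"
    by (simp add: \<delta>_def \<sigma>_def cf_d_def)
  have \<delta>2: "\<delta> q\<^sub>2 p\<^sub>2 = v"
    using lin[of 1 "cf_q \<alpha> m" k q\<^sub>1 "cf_p \<alpha> m" p\<^sub>1] \<delta>0 \<delta>1 by (simp add: q\<^sub>2_def p\<^sub>2_def v_def)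
  have det0: "q\<^sub>1 * cf_p \<alpha> m - cf_q \<alpha> m * p\<^sub>1 = (-1) ^ m"
    unfolding q\<^sub>1_def p\<^sub>1_def by (rule cf_det)
  have det': "q\<^sub>1 * p\<^sub>2 - q\<^sub>2 * p\<^sub>1 = q\<^sub>1 * cf_p \<alpha> m - cf_q \<alpha> m * p\<^sub>1"
    by (simp add: q\<^sub>2_def p\<^sub>2_def algebra_simps)
  have det: "\<bar>q\<^sub>1 * p\<^sub>2 - q\<^sub>2 * p\<^sub>1\<bar> = 1" unfolding det' det0 by (simp add: power_abs)
  \<comment> \<open>The determinant seen through \<open>\<delta>\<close>: the three return times,
    weighted by the lengths of their intervals in the window, add up to 1. This relation identifies
    Q' with \<open>\<epsilon> * of_int q\<^sub>2\<close>.\<close>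
  have "of_int q\<^sub>1 * \<delta> q\<^sub>2 p\<^sub>2 - of_int q\<^sub>2 * \<delta> q\<^sub>1 p\<^sub>1 = - \<sigma> * of_int (q\<^sub>1 * p\<^sub>2 - q\<^sub>2 * p\<^sub>1)"
    by (simp add: \<delta>_def algebra_simps)
  then have "of_int q\<^sub>1 * v + of_int q\<^sub>2 * u = - \<sigma> * of_int (q\<^sub>1 * p\<^sub>2 - q\<^sub>2 * p\<^sub>1)"
    using \<delta>1 \<delta>2 by simp
  also have "\<dots> = 1" unfolding det' det0 by (simp add: \<sigma>_def flip: power_add mult_2 power_mult_distrib)
  finally have q2: "of_int q\<^sub>1 * v + of_int q\<^sub>2 * u = 1" .
  have \<sigma>h: "\<bar>\<sigma> * h\<bar> < 1" using h \<sigma> by auto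
  have w: "0 \<le> w" "w \<le> \<epsilon>" using \<sigma>h \<epsilon> by (auto simp: w_def mult_le_cancel_right1)
  define qp where "qp = (if u \<le> w then (q\<^sub>1, p\<^sub>1) else if v \<le> \<epsilon> - w then (q\<^sub>2, p\<^sub>2) else (q\<^sub>1 + q\<^sub>2, p\<^sub>1 + p\<^sub>2))"
  obtain q p where qp: "(q, p) = qp" by (cases qp) auto
  note fr = first_return[of \<delta>, OF lin det q \<delta>1 u \<delta>2 v(3,1,2) w, of q p, folded qp_def, OF qp]
  have eq: "\<sigma> * (h + 2 * (of_int q * \<alpha> - of_int p) / \<epsilon>) = \<sigma> * h + 2 * \<delta> q p / \<epsilon>" for q p :: int
    by (simp add: \<delta>_def algebra_simps)
  have abs: "\<bar>\<sigma> * x\<bar> = \<bar>x\<bar>" for x using \<sigma> by auto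
  have win: "\<bar>h + 2 * (of_int q * \<alpha> - of_int p) / \<epsilon>\<bar> \<le> 1 \<longleftrightarrow> - w \<le> \<delta> q p \<and> \<delta> q p \<le> \<epsilon> - w" for q p :: int
  proof -
    have "\<bar>h + 2 * (of_int q * \<alpha> - of_int p) / \<epsilon>\<bar> = \<bar>\<sigma> * h + 2 * \<delta> q p / \<epsilon>\<bar>"
      by (metis eq abs)
    then show ?thesis using \<epsilon> by (auto simp: w_def abs_le_iff field_simps)
  qed
  have win': "\<bar>h + 2 * (of_int q * \<alpha> - of_int p) / \<epsilon>\<bar> < 1 \<longleftrightarrow> - w < \<delta> q p \<and> \<delta> q p < \<epsilon> - w" for q p :: int
  proof -
    have "\<bar>h + 2 * (of_int q * \<alpha> - of_int p) / \<epsilon>\<bar> = \<bar>\<sigma> * h + 2 * \<delta> q p / \<epsilon>\<bar>"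
      by (metis eq abs)
    then show ?thesis using \<epsilon> by (auto simp: w_def abs_less_iff field_simps)
  qed
  have A: "A_param \<alpha> r = 1 - u / \<epsilon>" and B: "B_param \<alpha> r = 1 - v / \<epsilon>" and Q: "Q_param \<alpha> r = \<epsilon> * of_int q\<^sub>1"
    by (simp_all add: A_param_def B_param_def Q_param_def m(1) u_def v_def k_def q\<^sub>1_def \<epsilon>_def)
  have Q': "(1 - \<epsilon> * of_int q\<^sub>1 * (v / \<epsilon>)) / (u / \<epsilon>) = \<epsilon> * of_int q\<^sub>2"
  proof -
    have "1 - \<epsilon> * of_int q\<^sub>1 * (v / \<epsilon>) = of_int q\<^sub>2 * u" using q2 \<epsilon> by simp
    then show ?thesis using u \<epsilon> by simp
  qed
  have shift: "h + 2 * (of_int q * \<alpha> - of_int p) / \<epsilon> = h + 2 * \<sigma> * (\<delta> q p / \<epsilon>)" for q p :: int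
  proof -
    have "2 * \<sigma> * (\<delta> q p / \<epsilon>) = \<sigma> * \<sigma> * (2 * (of_int q * \<alpha> - of_int p) / \<epsilon>)"
      by (simp add: \<delta>_def)
    then show ?thesis unfolding \<sigma>(2) by (simp only: mult_1)
  qed
  have "explicit_transfer (A_param \<alpha> r) (B_param \<alpha> r) (Q_param \<alpha> r) (N_index \<alpha> r) h =
        (\<epsilon> * of_int q, h + 2 * (of_int q * \<alpha> - of_int p) / \<epsilon>)"
    if less: "\<bar>h + 2 * (of_int q * \<alpha> - of_int p) / \<epsilon>\<bar> < 1"
  proof -
    have \<sigma>N: "(-1) ^ N_index \<alpha> r = \<sigma>" by (simp add: m(1) \<sigma>_def)
    have c1: "\<sigma> * h \<in> {1 - 2 * (1 - u / \<epsilon>)<..1} \<longleftrightarrow> u < w"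
      using \<sigma>h \<epsilon> by (auto simp: w_def field_simps)
    have c2: "\<sigma> * h \<in> {-1..<-1 + 2 * (1 - v / \<epsilon>)} \<longleftrightarrow> v < \<epsilon> - w"
      using \<sigma>h \<epsilon> by (auto simp: w_def field_simps)
    have c3: "\<sigma> * h \<in> {-1 + 2 * (1 - v / \<epsilon>)..1 - 2 * (1 - u / \<epsilon>)} \<longleftrightarrow> \<epsilon> - w \<le> v \<and> w \<le> u"
      using \<sigma>h \<epsilon> by (auto simp: w_def field_simps)
    have bnd: "- w < \<delta> q p" "\<delta> q p < \<epsilon> - w" using win' less by auto
    have dsum: "\<delta> (q\<^sub>1 + q\<^sub>2) (p\<^sub>1 + p\<^sub>2) = v - u"
      using lin[of 1 q\<^sub>1 1 q\<^sub>2 p\<^sub>1 p\<^sub>2] \<delta>1 \<delta>2 by simp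
    consider "u \<le> w" "q = q\<^sub>1" "p = p\<^sub>1" | "w < u" "v \<le> \<epsilon> - w" "q = q\<^sub>2" "p = p\<^sub>2"
      | "w < u" "\<epsilon> - w < v" "q = q\<^sub>1 + q\<^sub>2" "p = p\<^sub>1 + p\<^sub>2"
      using qp by (auto simp: qp_def split: if_splits)
    then show ?thesis
    proof cases
      case 1
      then have "u < w" using bnd \<delta>1 by simp
      then show ?thesis
        unfolding explicit_transfer_def Let_def \<sigma>N A B Q c1 c2 c3 shift using 1 \<delta>1 by simp
    next
      case 2
      then have "v < \<epsilon> - w" using bnd \<delta>2 by simp
      then show ?thesis
        unfolding explicit_transfer_def Let_def \<sigma>N A B Q c1 c2 c3 shift using 2 \<delta>2 Q' by simp
    next
      case 3
      have AB: "1 - u / \<epsilon> - (1 - v / \<epsilon>) = \<delta> q p / \<epsilon>"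
        using 3 dsum by (simp add: diff_divide_distrib)
      have "Q'' + \<epsilon> * of_int q\<^sub>1 = \<epsilon> * of_int q" if "Q'' = \<epsilon> * of_int q\<^sub>2" for Q''
        using that 3 by (simp add: algebra_simps)
      then show ?thesis
        unfolding explicit_transfer_def Let_def \<sigma>N A B Q c1 c2 c3 shift AB using 3 Q' by simp
    qed
  qed
  then show ?thesis
    using that[of q p] fr win unfolding \<epsilon>_def by blast
qed

section \<open>The first collision\<close>

text \<open>\<open>eps\<close> is the length of a vertical section of a strip of width
  \<open>2 * r\<close> in the direction \<theta>.\<close>

lemma eps_tan_mult_cos:
  assumes "0 < cos \<theta>"
  shows "eps (tan \<theta>) r * cos \<theta> = 2 * r"
proof -
  have "1 + (tan \<theta>)\<^sup>2 = (1 / cos \<theta>)\<^sup>2"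
    using assms sin_cos_squared_add[of \<theta>] by (simp add: tan_def field_simps power2_eq_square)
  then have "sqrt (1 + (tan \<theta>)\<^sup>2) = 1 / cos \<theta>" using assms by (simp add: real_sqrt_divide)
  then show ?thesis using assms by (simp add: eps_def)
qed

text \<open>Compares the component of (m, n) along the direction with the length of the segment of
  slope \<open>tan \<theta>\<close> over [0, m]; the difference is controlled by the deviation
  \<open>m * tan \<theta> - n\<close>.\<close>

lemma cos_sin_combination:
  fixes m n :: real
  assumes "0 < cos \<theta>"
  shows "m * cos \<theta> + n * sin \<theta> = m / cos \<theta> - (m * tan \<theta> - n) * sin \<theta>"
proof -
  have "m * (cos \<theta> * cos \<theta>) + m * (sin \<theta> * sin \<theta>) = m"
    by (metis distrib_left mult.right_neutral sin_cos_squared_add3)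
  then show ?thesis using assms by (simp add: tan_def field_simps power2_eq_square)
qed

text \<open>Along the ray, a reachable obstacle in column m lies within \<epsilon> of m / cos
  \<theta>, which grows by at least 1 from one column to the next, so obstacles are met in the order
  of their columns. \<open>T\<close> is the distance of the centres along the ray minus the
  half-chords cut in the two disks. The bound 1/10 leaves room in every comparison.\<close>

lemma first_hit:
  fixes q p :: int and x :: complex
  assumes r: "0 < r" and \<theta>: "0 < \<theta>" "\<theta> < pi / 4" and \<epsilon>: "eps (tan \<theta>) r < 1/10"
    and c: "c \<in> lattice" and h: "\<bar>h\<bar> < 1" and q: "0 < q"
    and g: "g = h + 2 * (of_int q * tan \<theta> - of_int p) / eps (tan \<theta>) r" "\<bar>g\<bar> \<le> 1"
    and first: "\<And>q' p' :: int. 0 < q' \<Longrightarrow>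
      \<bar>h + 2 * (of_int q' * tan \<theta> - of_int p') / eps (tan \<theta>) r\<bar> \<le> 1 \<Longrightarrow> q \<le> q'"
    and x: "x = c + r *\<^sub>R (cis \<theta> * Complex (sqrt (1 - h\<^sup>2)) h)"
    and T: "T = of_int q * cos \<theta> + of_int p * sin \<theta> - r * sqrt (1 - h\<^sup>2) - r * sqrt (1 - g\<^sup>2)"
  shows "exit_time r (x, cis \<theta>) = T"
    and "x + T *\<^sub>R cis \<theta> = c + Complex (of_int q) (of_int p) + r *\<^sub>R (cis \<theta> * Complex (- sqrt (1 - g\<^sup>2)) g)"
proof -
  define \<alpha> where "\<alpha> = tan \<theta>"
  define \<epsilon> where "\<epsilon> = eps \<alpha> r"
  define s where "s = sqrt (1 - h\<^sup>2)"
  have s: "0 \<le> s" "s \<le> 1" using h by (auto simp: s_def abs_square_le_1)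
  have cos: "0 < cos \<theta>" "cos \<theta> \<le> 1" and sin: "0 < sin \<theta>" "sin \<theta> \<le> 1"
    using \<theta> by (auto intro: cos_gt_zero sin_gt_zero)
  have e: "\<epsilon> * cos \<theta> = 2 * r"
    unfolding \<epsilon>_def \<alpha>_def by (rule eps_tan_mult_cos[OF cos(1)])
  have e': "0 < \<epsilon>" "2 * r \<le> \<epsilon>" "\<epsilon> < 1/10"
  proof -
    have "0 < \<epsilon> * cos \<theta>" unfolding e using r by simp
    then show "0 < \<epsilon>" using cos(1) zero_less_mult_pos2 by blast
    then have "\<epsilon> * cos \<theta> \<le> \<epsilon>" by (intro mult_left_le cos) simp
    then show "2 * r \<le> \<epsilon>" unfolding e .
    show "\<epsilon> < 1/10" using \<epsilon> by (simp add: \<epsilon>_def \<alpha>_def)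
  qed
  have r2: "r < 1/2" using e' by linarith
  \<comment> \<open>\<open>X\<close> is the position along the ray of a centre relative to
    \<open>c\<close>, and \<open>G\<close> the impact parameter of the ray with respect to that
    obstacle.\<close>
  define X where "X m n = of_int m * cos \<theta> + of_int n * sin \<theta>" for m n :: int
  define G where "G m n = h + 2 * (of_int m * \<alpha> - of_int n) / \<epsilon>" for m n :: int
  have G: "r * h - (of_int n * cos \<theta> - of_int m * sin \<theta>) = r * G m n" for m n
  proof -
    have "r * (2 * z / \<epsilon>) = cos \<theta> * z" for z
    proof -
      have "r * (2 * z / \<epsilon>) = (\<epsilon> * cos \<theta>) * z / \<epsilon>" unfolding e by simp
      then show ?thesis using e' by simp
    qed
    then have "r * (2 * (of_int m * \<alpha> - of_int n) / \<epsilon>) = cos \<theta> * (of_int m * \<alpha> - of_int n)" .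
    also have "\<dots> = of_int m * sin \<theta> - of_int n * cos \<theta>"
      using cos by (simp add: \<alpha>_def tan_def algebra_simps)
    finally show ?thesis by (simp add: G_def algebra_simps)
  qed
  have rot: "Complex (of_int m) (of_int n) = cis \<theta> * Complex (X m n) (of_int n * cos \<theta> - of_int m * sin \<theta>)" for m n
  proof -
    have "x * (cos \<theta>)\<^sup>2 + x * (sin \<theta>)\<^sup>2 = x" for x
      by (simp flip: distrib_left)
    then show ?thesis by (simp add: complex_eq_iff X_def power2_eq_square algebra_simps)
  qed
  have pos: "x + t *\<^sub>R cis \<theta> - (c + Complex (of_int m) (of_int n)) =
      cis \<theta> * Complex (t + r * s - X m n) (r * G m n)" for t m n
    unfolding rot G[symmetric] by (simp add: x complex_eq_iff s_def algebra_simps)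
  have hit: "x + t *\<^sub>R cis \<theta> \<in> frontier (billiard_table r) \<longleftrightarrow>
      (\<exists>m n. (t + r * s - X m n)\<^sup>2 + (r * G m n)\<^sup>2 = r\<^sup>2)" for t
  proof -
    have nrm: "dist (x + t *\<^sub>R cis \<theta>) (c + Complex (of_int m) (of_int n)) = r \<longleftrightarrow>
        (t + r * s - X m n)\<^sup>2 + (r * G m n)\<^sup>2 = r\<^sup>2" for m n
    proof -
      have "dist (x + t *\<^sub>R cis \<theta>) (c + Complex (of_int m) (of_int n)) =
          sqrt ((t + r * s - X m n)\<^sup>2 + (r * G m n)\<^sup>2)"
        unfolding dist_norm pos by (simp add: norm_mult complex_norm)
      then show ?thesis using r by (metis less_le real_sqrt_abs real_sqrt_eq_iff abs_of_nonneg)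
    qed
    have "(\<exists>d\<in>lattice. dist (x + t *\<^sub>R cis \<theta>) d = r) \<longleftrightarrow>
        (\<exists>m n. dist (x + t *\<^sub>R cis \<theta>) (c + Complex (of_int m) (of_int n)) = r)"
    proof
      assume "\<exists>d\<in>lattice. dist (x + t *\<^sub>R cis \<theta>) d = r"
      then obtain d where d: "d \<in> lattice" "dist (x + t *\<^sub>R cis \<theta>) d = r" by blast
      then obtain m n :: int where "d - c = Complex (of_int m) (of_int n)"
        using lattice_diff[OF d(1) c] unfolding lattice_def by blast
      then have "d = c + Complex (of_int m) (of_int n)" by (metis add.commute diff_add_cancel)
      then show "\<exists>m n. dist (x + t *\<^sub>R cis \<theta>) (c + Complex (of_int m) (of_int n)) = r"
        using d by blast
    next
      assume "\<exists>m n. dist (x + t *\<^sub>R cis \<theta>) (c + Complex (of_int m) (of_int n)) = r"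
      moreover have "c + Complex (of_int m) (of_int n) \<in> lattice" for m n
        by (rule lattice_add[OF c]) (auto simp: lattice_def)
      ultimately show "\<exists>d\<in>lattice. dist (x + t *\<^sub>R cis \<theta>) d = r" by blast
    qed
    then show ?thesis unfolding frontier_billiard_table[OF r r2] nrm .
  qed
  have G_le: "\<bar>of_int m * \<alpha> - of_int n\<bar> \<le> \<epsilon>" if "\<bar>G m n\<bar> \<le> 1" for m n
  proof -
    have "\<bar>2 * (of_int m * \<alpha> - of_int n) / \<epsilon>\<bar> \<le> 2" using that h unfolding G_def by linarith
    then show ?thesis using e' by (simp add: abs_mult field_simps)
  qed
  have Xd: "of_int m / cos \<theta> - \<epsilon> \<le> X m n" "X m n \<le> of_int m / cos \<theta> + \<epsilon>" if "\<bar>G m n\<bar> \<le> 1" for m n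
  proof -
    have "X m n = of_int m / cos \<theta> - (of_int m * \<alpha> - of_int n) * sin \<theta>"
      unfolding X_def \<alpha>_def by (rule cos_sin_combination[OF cos(1)])
    moreover have "\<bar>(of_int m * \<alpha> - of_int n) * sin \<theta>\<bar> \<le> \<epsilon> * 1"
      unfolding abs_mult by (intro mult_mono G_le that) (use sin e' in auto)
    ultimately show "of_int m / cos \<theta> - \<epsilon> \<le> X m n" "X m n \<le> of_int m / cos \<theta> + \<epsilon>" by linarith+
  qed
  have div: "of_int m / cos \<theta> + 1 \<le> of_int m' / cos \<theta>" if "m < m'" for m m' :: int
  proof -
    have "1 * 1 \<le> of_int (m' - m) * (1 / cos \<theta>)"
      by (intro mult_mono) (use that cos in auto)
    then show ?thesis by (simp add: diff_divide_distrib)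
  qed
  have gG: "g = G q p" by (simp add: g(1) G_def \<epsilon>_def \<alpha>_def)
  define a where "a = sqrt (1 - g\<^sup>2)"
  have g2: "g\<^sup>2 \<le> 1" using g(2) by (simp add: abs_square_le_1)
  then have a: "0 \<le> a" "a \<le> 1" "a\<^sup>2 = 1 - g\<^sup>2" by (auto simp: a_def)
  have T': "T = X q p - r * s - r * a" by (simp add: T X_def s_def a_def)
  have rs: "0 \<le> r * s" "r * s \<le> r" "0 \<le> r * a" "r * a \<le> r" using r s a by auto
  have scale: "(r * x)\<^sup>2 + (r * y)\<^sup>2 = r\<^sup>2" if "x\<^sup>2 + y\<^sup>2 = 1" for x y
  proof -
    have "(r * x)\<^sup>2 + (r * y)\<^sup>2 = r\<^sup>2 * (x\<^sup>2 + y\<^sup>2)" by (simp only: power_mult_distrib distrib_left)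
    then show ?thesis by (simp only: that mult_1_right)
  qed
  have rag: "(r * a)\<^sup>2 + (r * G q p)\<^sup>2 = r\<^sup>2" by (rule scale) (use a gG in simp)
  have "T > 0"
    using Xd(1)[of q p] div[of 0 q] q g(2) gG e' rs unfolding T' by simp
  moreover have "x + T *\<^sub>R cis \<theta> \<in> frontier (billiard_table r)"
  proof -
    have "T + r * s - X q p = - (r * a)" by (simp add: T')
    then have "(T + r * s - X q p)\<^sup>2 + (r * G q p)\<^sup>2 = r\<^sup>2" using rag by (simp only: power2_minus)
    then show ?thesis using hit by blast
  qed
  moreover have "T \<le> t" if t: "0 < t" "x + t *\<^sub>R cis \<theta> \<in> frontier (billiard_table r)" for t
  proof -
    obtain m n where mn: "(t + r * s - X m n)\<^sup>2 + (r * G m n)\<^sup>2 = r\<^sup>2"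
      using t hit by blast
    have "(r * G m n)\<^sup>2 \<le> r\<^sup>2" using mn by (metis le_add_same_cancel2 zero_le_power2)
    then have "r * \<bar>G m n\<bar> \<le> r * 1" using r by (simp add: abs_le_square_iff[symmetric] abs_mult)
    then have Gle: "\<bar>G m n\<bar> \<le> 1" using r by simp
    have "(t + r * s - X m n)\<^sup>2 \<le> r\<^sup>2" using mn by (metis le_add_same_cancel1 zero_le_power2)
    then have tX: "\<bar>t + r * s - X m n\<bar> \<le> r" using r by (simp add: abs_le_square_iff[symmetric])
    \<comment> \<open>A column behind the start would need a negative time. Column 0 only offers the
      obstacle being left, which the ray does not meet again. Columns ahead start at
      \<open>q\<close> by \<open>first\<close>, and those beyond \<open>q\<close> lie at least 1 - 2
      \<epsilon> further along, which exceeds \<open>r\<close>.\<close>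
    consider "m < 0" | "m = 0" | "0 < m" by linarith
    then show ?thesis
    proof cases
      case 1
      then show ?thesis using Xd(2)[OF Gle] div[of m 0] tX t rs e' by simp
    next
      case 2
      then have "\<bar>of_int n :: real\<bar> < 1" using G_le[OF Gle] e' by simp
      then have "n = 0" by linarith
      then have "(t + r * s)\<^sup>2 + (r * h)\<^sup>2 = r\<^sup>2" using mn \<open>m = 0\<close> by (simp add: X_def G_def)
      moreover have "(r * s)\<^sup>2 + (r * h)\<^sup>2 = r\<^sup>2"
        by (rule scale) (use h in \<open>simp add: s_def abs_square_le_1\<close>)
      ultimately have "(t + r * s)\<^sup>2 = (r * s)\<^sup>2" by linarith
      then have "t + r * s = r * s"
        by (rule power2_eq_imp_eq) (use t(1) rs(1) in linarith)+
      then show ?thesis using t by simp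
    next
      case 3
      then have "q \<le> m" using first[of m n] Gle by (simp add: G_def \<epsilon>_def \<alpha>_def)
      show ?thesis
      proof (cases "q = m")
        case True
        \<comment> \<open>Within one column, two reachable centres have heights less than 1 apart,
          so they coincide; \<open>T\<close> is the smaller of the two intersection times.\<close>
        have "\<bar>of_int p - of_int n :: real\<bar> \<le> 2 * \<epsilon>"
          using G_le[OF Gle] G_le[of q p] g(2) gG True by simp
        then have "n = p" using e' by linarith
        then have "(t + r * s - X q p)\<^sup>2 = (r * a)\<^sup>2"
          using mn True rag by simp
        then have "\<bar>t + r * s - X q p\<bar> = \<bar>r * a\<bar>" by (rule power2_eq_iff[THEN iffD1, THEN abs_eq_iff[THEN iffD2]])
        then show ?thesis using rs unfolding T' by linarith
      next
        case False
        then show ?thesis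
          using \<open>q \<le> m\<close> div[of q m] Xd(1)[OF Gle] Xd(2)[of q p] g(2) gG tX e' rs unfolding T' by simp
      qed
    qed
  qed
  ultimately show "exit_time r (x, cis \<theta>) = T"
    unfolding exit_time_def by (auto intro!: cInf_eq_minimum)
  have "x + T *\<^sub>R cis \<theta> - (c + Complex (of_int q) (of_int p)) = r *\<^sub>R (cis \<theta> * Complex (- a) g)"
    unfolding pos T' gG[symmetric] by (simp add: complex_eq_iff algebra_simps)
  then show "x + T *\<^sub>R cis \<theta> = c + Complex (of_int q) (of_int p) + r *\<^sub>R (cis \<theta> * Complex (- sqrt (1 - g\<^sup>2)) g)"
    unfolding a_def by (metis add.commute diff_add_cancel)
qed

section \<open>Specular reflection and the outcome of a collision\<close>

text \<open>Put z = \<open>Complex a b\<close>, so that n = v z. On the unit circle z^2 - 2 a z + 1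
  = 0, hence v' = - v z^2 and n = - v' / z, where - 1 / z = \<open>Complex (- a) b\<close>.
  Reflection flips the cosine of the angle to the normal and keeps its sine.\<close>

lemma reflect_polar:
  fixes v :: complex
  assumes "norm v = 1" "a\<^sup>2 + b\<^sup>2 = 1"
  defines "n \<equiv> v * Complex a b"
  defines "v' \<equiv> v - (2 * (v \<bullet> n)) *\<^sub>R n"
  shows "norm v' = 1" "n = v' * Complex (- a) b"
proof -
  have b: "b\<^sup>2 = 1 - a\<^sup>2" using assms(2) by linarith
  have "v' = v * (1 - of_real (2 * a) * Complex a b)"
    unfolding v'_def n_def inner_mult_unit[OF assms(1)]
    by (simp add: scaleR_conv_of_real algebra_simps)
  also have "1 - of_real (2 * a) * Complex a b = Complex (b\<^sup>2 - a\<^sup>2) (- 2 * a * b)"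
    unfolding b by (simp add: complex_eq_iff power2_eq_square)
  finally have v': "v' = v * Complex (b\<^sup>2 - a\<^sup>2) (- 2 * a * b)" .
  have "(b\<^sup>2 - a\<^sup>2)\<^sup>2 + (- 2 * a * b)\<^sup>2 = (a\<^sup>2 + b\<^sup>2)\<^sup>2"
    by (simp add: power2_eq_square algebra_simps)
  then show "norm v' = 1" unfolding v' using assms(1,2) by (simp add: norm_mult complex_norm)
  have "Complex (b\<^sup>2 - a\<^sup>2) (- 2 * a * b) * Complex (- a) b = Complex a b"
  proof -
    have "(b\<^sup>2 - a\<^sup>2) * - a + 2 * a * b * b = a * (a\<^sup>2 + b\<^sup>2)"
      "(b\<^sup>2 - a\<^sup>2) * b + 2 * a * b * a = b * (a\<^sup>2 + b\<^sup>2)"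
      by (simp_all add: power2_eq_square algebra_simps)
    then show ?thesis using assms(2) by (simp add: complex_eq_iff)
  qed
  then show "n = v' * Complex (- a) b" by (simp add: n_def v' mult.assoc)
qed

text \<open>The impact parameter can be read off before the reflection, since only the cosine
  changes sign. The second claim serves to exclude grazing collisions on
  \<open>transfer_dom\<close>.\<close>

lemma collision_outcome:
  assumes r: "0 < r" "r < 1/2" and c: "c \<in> lattice" and v: "norm v = 1" and ab: "a\<^sup>2 + b\<^sup>2 = 1"
    and y: "fst P + exit_time r P *\<^sub>R v = c + r *\<^sub>R (v * Complex a b)" and "snd P = v"
  shows "impact r (next_collision r P) = b"
    and "next_collision r P \<in> Gamma_plus r \<Longrightarrow> a < 0"
proof -
  define n where "n = v * Complex a b"
  define v' where "v' = v - (2 * (v \<bullet> n)) *\<^sub>R n"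
  have n: "unit_normal r (c + r *\<^sub>R n) = n"
    unfolding n_def by (rule unit_normal_eq[OF r c]) (use v norm_Complex_eq_1[OF ab] in \<open>simp add: norm_mult\<close>)
  have nc: "next_collision r P = (c + r *\<^sub>R n, v')"
    using y assms(7) n by (cases P) (simp add: next_collision_def Let_def v'_def n_def)
  have v': "norm v' = 1" "n = v' * Complex (- a) b"
    using reflect_polar[OF v ab] unfolding n_def v'_def by auto
  show "impact r (next_collision r P) = b"
    unfolding nc v'(2) by (rule impact_eq[OF r c v'(1)]) (use ab in simp)
  assume "next_collision r P \<in> Gamma_plus r"
  then have "0 < v' \<bullet> n" unfolding nc by (simp add: Gamma_plus_def n)
  then show "a < 0" using inner_mult_unit[OF v'(1), of "- a" b] v'(2) by simp
qed

section \<open>The error bound and the limit\<close>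

text \<open>Both sides refer to the same first obstacle, so the impact parameters agree exactly and
  the error sits in the flight time alone: it is \<open>2 * r\<close> times a correction of size at
  most \<epsilon> + 2 r, and \<epsilon> = 2 r / cos \<theta> yields the constant.\<close>

lemma transfer_error:
  assumes \<theta>: "0 < \<theta>" "\<theta> < pi / 4" and \<alpha>: "tan \<theta> \<notin> \<rat>" and h: "\<bar>h\<bar> < 1"
    and r: "0 < r" "eps (tan \<theta>) r < 1/10" and dom: "(h, cis \<theta>) \<in> transfer_dom r"
  defines "S \<equiv> explicit_transfer (A_param (tan \<theta>) r) (B_param (tan \<theta>) r)
    (Q_param (tan \<theta>) r) (N_index (tan \<theta>) r) h"
  shows "snd (transfer r (h, cis \<theta>)) = snd S"
    and "\<bar>fst (transfer r (h, cis \<theta>)) - fst S\<bar> \<le> (4 / cos \<theta> + 4) * r\<^sup>2"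
proof -
  define \<epsilon> where "\<epsilon> = eps (tan \<theta>) r"
  have cos: "0 < cos \<theta>" "cos \<theta> \<le> 1" and sin: "0 < sin \<theta>" "sin \<theta> \<le> 1"
    using \<theta> by (auto intro: cos_gt_zero sin_gt_zero)
  have tan: "0 < tan \<theta>" "tan \<theta> < 1"
    using \<theta> tan_gt_zero[of \<theta>] tan_monotone[of \<theta> "pi/4"] tan_45 by auto
  have \<epsilon>cos: "\<epsilon> * cos \<theta> = 2 * r" unfolding \<epsilon>_def by (rule eps_tan_mult_cos[OF cos(1)])
  then have \<epsilon>: "\<epsilon> = 2 * r / cos \<theta>" using cos by (simp add: field_simps)
  have \<epsilon>0: "0 < \<epsilon>" "\<epsilon> < 1/10" using r cos by (simp add: \<epsilon>) (use r in \<open>simp add: \<epsilon>_def\<close>)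
  have "\<epsilon> * cos \<theta> \<le> \<epsilon>" using cos \<epsilon>0 by (intro mult_left_le) auto
  then have r2: "r < 1/2" using \<epsilon>0 unfolding \<epsilon>cos by linarith
  have \<epsilon>1: "0 < eps (tan \<theta>) r" "eps (tan \<theta>) r < 1"
    using \<epsilon>0 by (simp_all add: \<epsilon>_def)
  obtain q p :: int where q: "0 < q"
    and g: "\<bar>h + 2 * (of_int q * tan \<theta> - of_int p) / \<epsilon>\<bar> \<le> 1"
    and first: "\<forall>q' p' :: int. 0 < q' \<longrightarrow> \<bar>h + 2 * (of_int q' * tan \<theta> - of_int p') / \<epsilon>\<bar> \<le> 1 \<longrightarrow> q \<le> q'"
    and S: "\<bar>h + 2 * (of_int q * tan \<theta> - of_int p) / \<epsilon>\<bar> < 1 \<longrightarrow>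
      S = (\<epsilon> * of_int q, h + 2 * (of_int q * tan \<theta> - of_int p) / \<epsilon>)"
    by (rule explicit_transfer_first_return[OF \<alpha> tan \<epsilon>1 h, folded S_def \<epsilon>_def])
  define g where "g = h + 2 * (of_int q * tan \<theta> - of_int p) / \<epsilon>"
  obtain c where c: "c \<in> lattice" and
    Y: "Y_rep r (h, cis \<theta>) = (c + r *\<^sub>R (cis \<theta> * Complex (sqrt (1 - h\<^sup>2)) h), cis \<theta>)"
    using Y_rep_eq[OF r(1) r2 _ h, of "cis \<theta>"] by auto
  define x where "x = c + r *\<^sub>R (cis \<theta> * Complex (sqrt (1 - h\<^sup>2)) h)"
  define T where "T = of_int q * cos \<theta> + of_int p * sin \<theta> - r * sqrt (1 - h\<^sup>2) - r * sqrt (1 - g\<^sup>2)"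
  have g1: "\<bar>g\<bar> \<le> 1" using g by (simp add: g_def)
  have hit: "exit_time r (x, cis \<theta>) = T"
    "x + T *\<^sub>R cis \<theta> = c + Complex (of_int q) (of_int p) + r *\<^sub>R (cis \<theta> * Complex (- sqrt (1 - g\<^sup>2)) g)"
    using first_hit[OF r(1) \<theta> r(2) c h q _ g1 _ x_def T_def] first
    unfolding \<epsilon>_def[symmetric] g_def by blast+
  have g2: "g\<^sup>2 \<le> 1" using g1 by (simp add: abs_square_le_1)
  have c': "c + Complex (of_int q) (of_int p) \<in> lattice"
    by (rule lattice_add[OF c]) (auto simp: lattice_def)
  have Yx: "Y_rep r (h, cis \<theta>) = (x, cis \<theta>)" using Y by (simp add: x_def)
  note out = collision_outcome[OF r(1) r2 c', of "cis \<theta>" "- sqrt (1 - g\<^sup>2)" g "(x, cis \<theta>)"]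
  have "next_collision r (x, cis \<theta>) \<in> Gamma_plus r"
    using dom Yx by (simp add: transfer_dom_def)
  \<comment> \<open>With \<open>g\<^sup>2 = 1\<close> the cosine
    \<open>- sqrt (1 - g\<^sup>2)\<close> would be 0, against the strict sign that
    \<open>transfer_dom\<close> provides.\<close>
  then have "g\<^sup>2 \<noteq> 1" using out(2) hit g2 by auto
  then have "\<bar>g\<bar> < 1" using g1 by (metis abs_1 less_le one_power2 power2_abs)
  then have S: "S = (\<epsilon> * of_int q, g)" using S by (simp add: g_def)
  have tr: "transfer r (h, cis \<theta>) = (2 * r * T, g)"
    using out(1) hit g2 by (simp add: transfer_def Yx)
  show "snd (transfer r (h, cis \<theta>)) = snd S" by (simp add: tr S)
  \<comment> \<open>Everything in the flight time except q / cos \<theta>, whose product with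
    \<open>2 * r\<close> is exactly \<open>\<epsilon> * of_int q\<close>.\<close>
  define D where "D = (of_int q * tan \<theta> - of_int p) * sin \<theta> + r * sqrt (1 - h\<^sup>2) + r * sqrt (1 - g\<^sup>2)"
  have T: "T = of_int q / cos \<theta> - D"
    using cos_sin_combination[OF cos(1), of "of_int q" "of_int p"] by (simp add: T_def D_def)
  have "fst (transfer r (h, cis \<theta>)) - fst S = - (2 * r) * D"
    by (simp add: tr S \<epsilon> T algebra_simps)
  then have eq: "\<bar>fst (transfer r (h, cis \<theta>)) - fst S\<bar> = 2 * r * \<bar>D\<bar>"
    using r by (simp add: abs_mult)
  have "\<bar>2 * (of_int q * tan \<theta> - of_int p) / \<epsilon>\<bar> \<le> 2" using g1 h unfolding g_def by linarith
  then have "\<bar>of_int q * tan \<theta> - of_int p\<bar> \<le> \<epsilon>" using \<epsilon>0 by (simp add: abs_mult field_simps)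
  then have "\<bar>(of_int q * tan \<theta> - of_int p) * sin \<theta>\<bar> \<le> \<epsilon> * 1"
    unfolding abs_mult by (intro mult_mono) (use sin \<epsilon>0 in auto)
  moreover have "0 \<le> r * sqrt (1 - h\<^sup>2)" "r * sqrt (1 - h\<^sup>2) \<le> r"
    "0 \<le> r * sqrt (1 - g\<^sup>2)" "r * sqrt (1 - g\<^sup>2) \<le> r"
    using r h g2 by (auto simp: mult_left_le abs_square_le_1)
  ultimately have "\<bar>D\<bar> \<le> \<epsilon> + 2 * r" unfolding D_def by linarith
  then have "2 * r * \<bar>D\<bar> \<le> 2 * r * (\<epsilon> + 2 * r)" using r by (intro mult_left_mono) auto
  then show "\<bar>fst (transfer r (h, cis \<theta>)) - fst S\<bar> \<le> (4 / cos \<theta> + 4) * r\<^sup>2"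
    unfolding eq by (simp add: \<epsilon> algebra_simps power2_eq_square)
qed

theorem proposition2p1:
  fixes \<theta> \<alpha> h :: real and \<omega> :: complex
  assumes "0 < \<theta>" "\<theta> < pi / 4"
    and "\<omega> = cis \<theta>" "\<alpha> = tan \<theta>" "\<alpha> \<notin> \<rat>"
    and "h \<in> {-1<..<1}"
  shows "\<exists>e :: real \<Rightarrow> real. e \<in> O[at_right 0](\<lambda>r. r\<^sup>2) \<and>
           (\<forall>\<^sub>F r in at_right 0. (h, \<omega>) \<in> transfer_dom r \<longrightarrow>
              transfer r (h, \<omega>) =
                explicit_transfer (A_param \<alpha> r) (B_param \<alpha> r) (Q_param \<alpha> r) (N_index \<alpha> r) h
                + (e r, 0))"
proof -
  define S where "S r = explicit_transfer (A_param \<alpha> r) (B_param \<alpha> r) (Q_param \<alpha> r) (N_index \<alpha> r) h" for r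
  \<comment> \<open>The value 0 off \<open>transfer_dom\<close>, where the equation claims nothing,
    keeps the bound valid for every small \<open>r\<close>.\<close>
  define e where "e r = (if (h, \<omega>) \<in> transfer_dom r then fst (transfer r (h, \<omega>)) - fst (S r) else 0)" for r
  have h: "\<bar>h\<bar> < 1" using assms(6) by auto
  have "((\<lambda>r. eps \<alpha> r) \<longlongrightarrow> 2 * 0 * sqrt (1 + \<alpha>\<^sup>2)) (at_right 0)"
    unfolding eps_def by (intro tendsto_intros)
  then have small: "\<forall>\<^sub>F r in at_right 0. eps \<alpha> r < 1/10"
    by (rule order_tendstoD) simp
  have pos: "\<forall>\<^sub>F r in at_right (0::real). 0 < r" by (rule eventually_at_right_less)
  note err = transfer_error[OF assms(1,2) _ h, folded assms(3,4), OF assms(5), folded S_def]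
  have "0 < cos \<theta>" using assms by (intro cos_gt_zero) auto
  have "\<forall>\<^sub>F r in at_right 0. norm (e r) \<le> (4 / cos \<theta> + 4) * norm (r\<^sup>2)"
    using small pos
  proof eventually_elim
    case (elim r)
    then show ?case using err(2)[of r] \<open>0 < cos \<theta>\<close> by (auto simp: e_def)
  qed
  then have "e \<in> O[at_right 0](\<lambda>r. r\<^sup>2)" by (rule bigoI)
  moreover have "\<forall>\<^sub>F r in at_right 0. (h, \<omega>) \<in> transfer_dom r \<longrightarrow> transfer r (h, \<omega>) = S r + (e r, 0)"
    using small pos
  proof eventually_elim
    case (elim r)
    then show ?case using err(1)[of r] by (auto simp: e_def prod_eq_iff)
  qed
  ultimately show ?thesis unfolding S_def by blast
qed

end
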